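(* Let $X$ be a compact metric space, let $f\colon X\to X$ be a continuous map, and let $x\in X$ be a shadowable point for $f$ (i.e. $x\in Sh(f)$). Then the following conditions are equivalent: (a) $x\in USC(\omega_f)$, i.e. the set-valued map $\omega_f$ is upper semicontinuous at $x$; (b) $\omega_f(x)=\Omega_f(x)$.
   Context: $(X,d)$ is a compact metric space, $f\colon X\to X$ is continuous, and $\mathcal{K}(X)$ is the set of non-empty closed subsets of $X$. $\omega_f(x)$ is the set of $y\in X$ such that $\lim_{j\to\infty}f^{i_j}(x)=y$ for some $0\le i_1<i_2<\cdots$; $\omega_f$ is regarded as a map $X\to\mathcal{K}(X)$. $\Omega_f(x)$ is the set of $y\in X$ for which there are $x_j\in X$, $j\ge1$, and $0\le i_1<i_2<\cdots$ with $\lim_{j\to\infty}x_j=x$ and $\lim_{j\to\infty}f^{i_j}(x_j)=y$. A map $\phi\colon X\to\mathcal{K}(X)$ is upper semicontinuous at $x$ if for every open $U\subset X$ with $\phi(x)\subset U$ there is $\delta>0$ such that $d(x,y)\le\delta$ implies $\phi(y)\subset U$ for all $y\in X$. $USC(\phi)$ is the set of upper semicontinuity points of $\phi$. For $\delta>0$, a sequence $(x_i)_{i\ge0}$ in $X$ is a $\delta$-pseudo orbit of $f$ if $\sup_{i\ge0}d(f(x_i),x_{i+1})\le\delta$; it is $\epsilon$-shadowed by $y\in X$ if $\sup_{i\ge0}d(x_i,f^i(y))\le\epsilon$. A point $x\in X$ is shadowable for $f$ if for every $\epsilon>0$ there is $\delta>0$ such that every $\delta$-pseudo orbit $(x_i)_{i\ge0}$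 of $f$ with $x_0=x$ is $\epsilon$-shadowed by some $y\in X$. $Sh(f)$ is the set of shadowable points. *)

theory Defs
  imports "HOL-Analysis.Analysis"
begin

text \<open>The compact metric space is a carrier set \<open>X\<close> in a metric type, with \<open>f\<close> mapping \<open>X\<close>
  into itself. Sequences indexed by \<open>j \<ge> 1\<close> are indexed by all of \<open>nat\<close>, starting at 0.\<close>

definition closed_hyperspace :: "'a::metric_space set \<Rightarrow> 'a set set" where
  "closed_hyperspace X = {A. A \<noteq> {} \<and> closedin (top_of_set X) A}"

definition omega_limit :: "'a::metric_space set \<Rightarrow> ('a \<Rightarrow> 'a) \<Rightarrow> 'a \<Rightarrow> 'a set" where
  "omega_limit X f x =
     {y \<in> X. \<exists>i :: nat \<Rightarrow> nat. strict_mono i \<and> (\<lambda>j. (f ^^ i j) x) \<longlonglongrightarrow> y}"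

definition Omega_limit :: "'a::metric_space set \<Rightarrow> ('a \<Rightarrow> 'a) \<Rightarrow> 'a \<Rightarrow> 'a set" where
  "Omega_limit X f x =
     {y \<in> X. \<exists>(\<xi> :: nat \<Rightarrow> 'a) (i :: nat \<Rightarrow> nat).
        range \<xi> \<subseteq> X \<and> strict_mono i \<and> \<xi> \<longlonglongrightarrow> x \<and> (\<lambda>j. (f ^^ i j) (\<xi> j)) \<longlonglongrightarrow> y}"

definition usc_at :: "'a::metric_space set \<Rightarrow> ('a \<Rightarrow> 'a set) \<Rightarrow> 'a \<Rightarrow> bool" where
  "usc_at X \<phi> x \<longleftrightarrow>
     (\<forall>U. openin (top_of_set X) U \<and> \<phi> x \<subseteq> U \<longrightarrow>
        (\<exists>\<delta>>0. \<forall>y\<in>X. dist x y \<le> \<delta> \<longrightarrow> \<phi> y \<subseteq> U))"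

definition USC :: "'a::metric_space set \<Rightarrow> ('a \<Rightarrow> 'a set) \<Rightarrow> 'a set" where
  "USC X \<phi> = {x \<in> X. usc_at X \<phi> x}"

text \<open>The bounds \<open>sup\<^sub>i d(\<dots>) \<le> \<delta>\<close> are stated pointwise, since \<open>Sup\<close> on \<open>real\<close> is unspecified for
  unbounded sets.\<close>

definition pseudo_orbit ::
    "'a::metric_space set \<Rightarrow> ('a \<Rightarrow> 'a) \<Rightarrow> real \<Rightarrow> (nat \<Rightarrow> 'a) \<Rightarrow> bool" where
  "pseudo_orbit X f \<delta> \<xi> \<longleftrightarrow> range \<xi> \<subseteq> X \<and> (\<forall>i. dist (f (\<xi> i)) (\<xi> (Suc i)) \<le> \<delta>)"

definition shadowed_by ::
    "('a::metric_space \<Rightarrow> 'a) \<Rightarrow> real \<Rightarrow> (nat \<Rightarrow> 'a) \<Rightarrow> 'a \<Rightarrow> bool" where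
  "shadowed_by f \<epsilon> \<xi> y \<longleftrightarrow> (\<forall>i. dist (\<xi> i) ((f ^^ i) y) \<le> \<epsilon>)"

definition shadowable :: "'a::metric_space set \<Rightarrow> ('a \<Rightarrow> 'a) \<Rightarrow> 'a \<Rightarrow> bool" where
  "shadowable X f x \<longleftrightarrow>
     (\<forall>\<epsilon>>0. \<exists>\<delta>>0. \<forall>\<xi>. pseudo_orbit X f \<delta> \<xi> \<and> \<xi> 0 = x \<longrightarrow> (\<exists>y\<in>X. shadowed_by f \<epsilon> \<xi> y))"

definition Sh :: "'a::metric_space set \<Rightarrow> ('a \<Rightarrow> 'a) \<Rightarrow> 'a set" where
  "Sh X f = {x \<in> X. shadowable X f x}"

lemma funpow_in_carrier: "f ` X \<subseteq> X \<Longrightarrow> x \<in> X \<Longrightarrow> (f ^^ n) x \<in> X"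
  by (induction n) auto

lemma ex_strict_mono_tendsto_iff:
  fixes u :: "nat \<Rightarrow> 'a::metric_space"
  shows "(\<exists>i :: nat \<Rightarrow> nat. strict_mono i \<and> (\<lambda>j. u (i j)) \<longlonglongrightarrow> y) \<longleftrightarrow>
         (\<forall>e>0. \<forall>n. \<exists>m\<ge>n. dist (u m) y < e)"
proof (intro iffI allI impI)
  fix e :: real and n
  assume "\<exists>i :: nat \<Rightarrow> nat. strict_mono i \<and> (\<lambda>j. u (i j)) \<longlonglongrightarrow> y" and "e > 0"
  then obtain i :: "nat \<Rightarrow> nat" and N where i: "strict_mono i"
    and N: "\<And>j. j \<ge> N \<Longrightarrow> dist (u (i j)) y < e"
    unfolding lim_sequentially by blast
  have "i (max n N) \<ge> n"
    using seq_suble[OF i, of "max n N"] by simp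
  then show "\<exists>m\<ge>n. dist (u m) y < e"
    using N[of "max n N"] by auto
next
  assume *: "\<forall>e>0. \<forall>n. \<exists>m\<ge>n. dist (u m) y < e"
  define s where "s = (\<lambda>n k. SOME m. m > k \<and> dist (u m) y < inverse (real (Suc n)))"
  have s: "s n k > k \<and> dist (u (s n k)) y < inverse (real (Suc n))" for n k
  proof -
    obtain m where "m \<ge> Suc k" "dist (u m) y < inverse (real (Suc n))"
      using *[rule_format, of "inverse (real (Suc n))" "Suc k"] by auto
    then have "m > k \<and> dist (u m) y < inverse (real (Suc n))"
      by simp
    then show ?thesis
      unfolding s_def by (rule someI)
  qed
  define i where "i = rec_nat (s 0 0) (\<lambda>n r. s (Suc n) r)"
  have "strict_mono i"
    unfolding strict_mono_Suc_iff by (simp add: i_def s)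
  moreover have "dist (u (i j)) y \<le> inverse (real (Suc j))" for j
    by (cases j) (simp_all only: i_def nat.rec s less_imp_le)
  then have "(\<lambda>j. dist (u (i j)) y) \<longlonglongrightarrow> 0"
    by (intro tendsto_sandwich[OF _ _ tendsto_const LIMSEQ_inverse_real_of_nat]
        always_eventually allI) simp_all
  then have "(\<lambda>j. u (i j)) \<longlonglongrightarrow> y"
    by (rule iffD2[OF tendsto_dist_iff])
  ultimately show "\<exists>i :: nat \<Rightarrow> nat. strict_mono i \<and> (\<lambda>j. u (i j)) \<longlonglongrightarrow> y"
    by blast
qed

lemma omega_limit_in_closed_hyperspace:
  assumes "compact X" and "f ` X \<subseteq> X" and "x \<in> X"
  shows "omega_limit X f x \<in> closed_hyperspace X"
proof -
  have "\<forall>n. (f ^^ n) x \<in> X"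
    using funpow_in_carrier[OF assms(2,3)] by simp
  then obtain l r where "l \<in> X" "strict_mono (r :: nat \<Rightarrow> nat)" "((\<lambda>n. (f ^^ n) x) \<circ> r) \<longlonglongrightarrow> l"
    by (rule seq_compactE[OF assms(1)[unfolded compact_eq_seq_compact_metric]])
  then have "omega_limit X f x \<noteq> {}"
    unfolding omega_limit_def by (auto simp: comp_def)
  moreover have eq: "omega_limit X f x = {y \<in> X. \<forall>e>0. \<forall>n. \<exists>m\<ge>n. dist ((f ^^ m) x) y < e}"
    unfolding omega_limit_def ex_strict_mono_tendsto_iff[of "\<lambda>n. (f ^^ n) x"] ..
  have "closed (omega_limit X f x)"
    unfolding closed_sequential_limits
  proof (intro allI impI, elim conjE)
    fix \<eta> l
    assume \<eta>: "\<forall>n. \<eta> n \<in> omega_limit X f x" and lim: "\<eta> \<longlonglongrightarrow> l"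
    have "l \<in> X"
      using \<eta> lim compact_imp_closed[OF assms(1)] closed_sequentially[of X \<eta> l] unfolding eq by blast
    moreover have "\<exists>m\<ge>n. dist ((f ^^ m) x) l < e" if "e > 0" for e n
    proof -
      obtain k where k: "dist (\<eta> k) l < e / 2"
        using lim \<open>e > 0\<close> metric_LIMSEQ_D[of \<eta> l "e / 2"] by auto
      obtain m where "m \<ge> n" "dist ((f ^^ m) x) (\<eta> k) < e / 2"
        using \<eta>[rule_format, of k, unfolded eq] \<open>e > 0\<close> half_gt_zero by blast
      then show ?thesis
        using k dist_triangle_half_r[of "\<eta> k" "(f ^^ m) x" e l] by (auto simp: dist_commute)
    qed
    ultimately show "l \<in> omega_limit X f x"
      unfolding eq by blast
  qed
  moreover have "omega_limit X f x \<subseteq> X"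
    unfolding omega_limit_def by blast
  ultimately show ?thesis
    unfolding closed_hyperspace_def by (simp add: closed_subset)
qed

end

theory Submission
  imports Defs
begin

text \<open>The graph of \<open>\<Omega>\<close> is closed, being an upper limit of the graphs of the iterates of \<open>f\<close>, so \<open>\<Omega>\<close>
  is upper semicontinuous everywhere; as \<open>\<omega> \<subseteq> \<Omega>\<close>, equality at \<open>x\<close> makes \<open>\<omega>\<close> upper semicontinuous
  at \<open>x\<close>. Conversely, let \<open>\<omega>\<close> be upper semicontinuous at \<open>x\<close> and \<open>y \<in> \<Omega>(x)\<close>. Then \<open>\<omega>(x)\<close> meets
  \<open>\<Omega>(y)\<close>: otherwise disjoint neighbourhoods of these two closed sets would both contain \<open>\<omega>(a)\<close> for
  an orbit that starts at some \<open>a\<close> near \<open>x\<close> and later passes near \<open>y\<close>. On the other hand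
  \<open>y \<in> \<Omega>(w)\<close> for every \<open>w \<in> \<omega>(x)\<close>. Since \<open>v \<in> \<Omega>(u)\<close> provides pseudo orbits from \<open>u\<close> to \<open>v\<close> with
  arbitrarily small jumps, there are such pseudo orbits that start at \<open>x\<close> and visit \<open>y\<close> infinitely
  often. A point shadowing one of them is near \<open>x\<close> and has limit points near \<open>y\<close>, so by upper
  semicontinuity \<open>y \<in> \<omega>(x)\<close>.\<close>

subsection \<open>Upper limits of sequences of sets\<close>

definition kuratowski_limsup :: "(nat \<Rightarrow> 'a::topological_space set) \<Rightarrow> 'a set" where
  "kuratowski_limsup S = (\<Inter>n. closure (\<Union>m\<in>{n..}. S m))"

lemma closed_kuratowski_limsup: "closed (kuratowski_limsup S)"
  unfolding kuratowski_limsup_def by (intro closed_INT ballI closed_closure)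

lemma kuratowski_limsup_iff_frequently:
  "l \<in> kuratowski_limsup S \<longleftrightarrow>
     (\<forall>U. open U \<longrightarrow> l \<in> U \<longrightarrow> (\<exists>\<^sub>F m in sequentially. S m \<inter> U \<noteq> {}))"
  unfolding kuratowski_limsup_def frequently_sequentially INT_iff closure_iff_nhds_not_empty by blast

lemma kuratowski_limsup_offset: "kuratowski_limsup (\<lambda>m. S (m + k)) = kuratowski_limsup S"
proof (rule Set.set_eqI)
  fix l
  show "l \<in> kuratowski_limsup (\<lambda>m. S (m + k)) \<longleftrightarrow> l \<in> kuratowski_limsup S"
    unfolding kuratowski_limsup_iff_frequently frequently_def
    by (simp only: eventually_sequentially_seg[of "\<lambda>m. \<not> S m \<inter> U \<noteq> {}" for U])
qed

lemma kuratowski_limsup_iff_sequential: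
  fixes l :: "'a::first_countable_topology"
  shows "l \<in> kuratowski_limsup S \<longleftrightarrow>
    (\<exists>(i :: nat \<Rightarrow> nat) u. strict_mono i \<and> (\<forall>j. u j \<in> S (i j)) \<and> u \<longlonglongrightarrow> l)"
proof
  assume l: "l \<in> kuratowski_limsup S"
  obtain A :: "nat \<Rightarrow> 'a set" where A: "\<And>n. open (A n)" "\<And>n. l \<in> A n"
    and lim: "\<And>u. \<forall>n. u n \<in> A n \<Longrightarrow> u \<longlonglongrightarrow> l"
    using first_countable_topology_class.countable_basis by blast
  have "\<exists>p. snd p \<in> S (fst p) \<inter> A n \<and> k < fst p" for n k
  proof -
    obtain m where "m \<ge> Suc k" "S m \<inter> A n \<noteq> {}"
      using l A unfolding kuratowski_limsup_iff_frequently frequently_sequentially by meson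
    then show ?thesis
      by fastforce
  qed
  then obtain p where "\<And>n. snd (p n) \<in> S (fst (p n)) \<inter> A n" "\<And>n. fst (p n) < fst (p (Suc n))"
    using dependent_nat_choice[of "\<lambda>n p. snd p \<in> S (fst p) \<inter> A n" "\<lambda>_ p q. fst p < fst q"] by meson
  then have "strict_mono (fst \<circ> p) \<and> (\<forall>j. (snd \<circ> p) j \<in> S ((fst \<circ> p) j)) \<and> (snd \<circ> p) \<longlonglongrightarrow> l"
    by (intro conjI lim) (auto simp: strict_mono_Suc_iff)
  then show "\<exists>(i :: nat \<Rightarrow> nat) u. strict_mono i \<and> (\<forall>j. u j \<in> S (i j)) \<and> u \<longlonglongrightarrow> l"
    by blast
next
  assume "\<exists>(i :: nat \<Rightarrow> nat) u. strict_mono i \<and> (\<forall>j. u j \<in> S (i j)) \<and> u \<longlonglongrightarrow> l"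
  then obtain i :: "nat \<Rightarrow> nat" and u
    where i: "strict_mono i" and u: "\<And>j. u j \<in> S (i j)" and lim: "u \<longlonglongrightarrow> l"
    by blast
  have "l \<in> closure (\<Union>m\<in>{n..}. S m)" for n
  proof (rule Lim_in_closed_set[OF closed_closure _ sequentially_bot lim])
    have "u j \<in> closure (\<Union>m\<in>{n..}. S m)" if "n \<le> j" for j
      using u[of j] le_trans[OF that seq_suble[OF i]] closure_subset by fastforce
    then show "\<forall>\<^sub>F j in sequentially. u j \<in> closure (\<Union>m\<in>{n..}. S m)"
      by (rule eventually_sequentiallyI)
  qed
  then show "l \<in> kuratowski_limsup S"
    unfolding kuratowski_limsup_def by blast
qed

lemma kuratowski_limsup_meets_compact:
  assumes "compact K" and freq: "\<exists>\<^sub>F m in sequentially. S m \<inter> K \<noteq> {}"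
  shows "K \<inter> kuratowski_limsup S \<noteq> {}"
  unfolding kuratowski_limsup_def
proof (rule compact_imp_fip_image[OF \<open>compact K\<close>])
  fix I :: "nat set"
  assume "finite I"
  then obtain b where b: "\<And>n. n \<in> I \<Longrightarrow> n \<le> b"
    unfolding finite_nat_set_iff_bounded_le by blast
  obtain m v where "m \<ge> b" "v \<in> S m" "v \<in> K"
    using freq unfolding frequently_sequentially by blast
  moreover have "v \<in> closure (\<Union>m\<in>{n..}. S m)" if "n \<in> I" for n
    using \<open>v \<in> S m\<close> le_trans[OF b[OF that] \<open>m \<ge> b\<close>] closure_subset by fastforce
  ultimately show "K \<inter> (\<Inter>n\<in>I. closure (\<Union>m\<in>{n..}. S m)) \<noteq> {}"
    by blast
qed simp

subsection \<open>Upper semicontinuity\<close>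

lemma usc_atE:
  assumes "usc_at X \<phi> x" "open U" "\<phi> x \<subseteq> X \<inter> U"
  obtains d where "d > 0" "\<And>y. y \<in> X \<Longrightarrow> dist x y \<le> d \<Longrightarrow> \<phi> y \<subseteq> U"
  using assms openin_open_Int[OF \<open>open U\<close>, of X] unfolding usc_at_def by (metis le_inf_iff)

lemma usc_at_if_subset_usc_at:
  assumes "usc_at X \<psi> x" "\<psi> x \<subseteq> \<phi> x" "\<And>y. y \<in> X \<Longrightarrow> \<phi> y \<subseteq> \<psi> y"
  shows "usc_at X \<phi> x"
  using assms unfolding usc_at_def by (meson order_trans)

lemma usc_at_if_closed_graph:
  assumes "compact X" and graph: "closed (Sigma X \<phi>)" and ran: "\<And>y. y \<in> X \<Longrightarrow> \<phi> y \<subseteq> X"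
  shows "usc_at X \<phi> x"
  unfolding usc_at_def
proof (intro allI impI, elim conjE)
  fix U
  assume "openin (top_of_set X) U" and sub: "\<phi> x \<subseteq> U"
  then obtain T where "open T" and U: "U = X \<inter> T"
    unfolding openin_open by blast
  define K where "K = fst ` (X \<times> X \<inter> (Sigma X \<phi> \<inter> UNIV \<times> - T))"
  have "closed (Sigma X \<phi> \<inter> UNIV \<times> - T)"
    using \<open>open T\<close> by (intro closed_Int graph closed_Times closed_UNIV closed_Compl)
  then have "compact K"
    unfolding K_def using \<open>compact X\<close>
    by (intro compact_continuous_image compact_Int_closed compact_Times continuous_on_fst continuous_on_id)
  moreover have "x \<notin> K"
    using sub by (auto simp: K_def U)
  ultimately obtain \<delta> where "\<delta> > 0" and \<delta>: "cball x \<delta> \<subseteq> - K"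
    using open_contains_cball[of "- K"] compact_imp_closed by blast
  have "\<phi> y \<subseteq> U" if "y \<in> X" "dist x y \<le> \<delta>" for y
  proof
    fix z
    assume "z \<in> \<phi> y"
    moreover have "y \<notin> K"
      using \<delta> that(2) by auto
    ultimately show "z \<in> U"
      using that(1) ran[OF that(1)] by (force simp: K_def U)
  qed
  then show "\<exists>\<delta>>0. \<forall>y\<in>X. dist x y \<le> \<delta> \<longrightarrow> \<phi> y \<subseteq> U"
    using \<open>\<delta> > 0\<close> by blast
qed

subsection \<open>The limit sets \<open>\<omega>\<close> and \<open>\<Omega>\<close>\<close>

lemma omega_limit_eq_kuratowski_limsup:
  "omega_limit X f x = X \<inter> kuratowski_limsup (\<lambda>m. {(f ^^ m) x})"
proof -
  have "(\<forall>j. u j \<in> {(f ^^ i j) x}) \<longleftrightarrow> u = (\<lambda>j. (f ^^ i j) x)" for u and i :: "nat \<Rightarrow> nat"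
    by auto
  then show ?thesis
    by (auto simp: omega_limit_def kuratowski_limsup_iff_sequential)
qed

lemma closed_omega_limit: "compact X \<Longrightarrow> closed (omega_limit X f x)"
  unfolding omega_limit_eq_kuratowski_limsup
  by (intro closed_Int compact_imp_closed closed_kuratowski_limsup)

lemma omega_limit_funpow: "omega_limit X f ((f ^^ k) x) = omega_limit X f x"
  using kuratowski_limsup_offset[of "\<lambda>m. {(f ^^ m) x}" k]
  by (simp add: omega_limit_eq_kuratowski_limsup funpow_add)

lemma omega_limit_meets_compact:
  assumes "compact K" "K \<subseteq> X" "\<exists>\<^sub>F m in sequentially. (f ^^ m) x \<in> K"
  shows "K \<inter> omega_limit X f x \<noteq> {}"
  using kuratowski_limsup_meets_compact[OF assms(1), of "\<lambda>m. {(f ^^ m) x}"] assms(2,3)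
  by (auto simp: omega_limit_eq_kuratowski_limsup)

definition funpow_graph :: "'a set \<Rightarrow> ('a \<Rightarrow> 'a) \<Rightarrow> nat \<Rightarrow> ('a \<times> 'a) set" where
  "funpow_graph X f m = (\<lambda>a. (a, (f ^^ m) a)) ` X"

lemma Omega_limitI:
  assumes "y \<in> X" "range \<xi> \<subseteq> X" "strict_mono (i :: nat \<Rightarrow> nat)"
    and "\<xi> \<longlonglongrightarrow> x" "(\<lambda>j. (f ^^ i j) (\<xi> j)) \<longlonglongrightarrow> y"
  shows "y \<in> Omega_limit X f x"
  using assms unfolding Omega_limit_def by blast

lemma Omega_limit_iff_kuratowski_limsup:
  "y \<in> Omega_limit X f x \<longleftrightarrow> y \<in> X \<and> (x, y) \<in> kuratowski_limsup (funpow_graph X f)"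
proof
  assume "y \<in> Omega_limit X f x"
  then obtain \<xi> and i :: "nat \<Rightarrow> nat" where "y \<in> X" and \<xi>: "range \<xi> \<subseteq> X" "\<xi> \<longlonglongrightarrow> x"
    and i: "strict_mono i" "(\<lambda>j. (f ^^ i j) (\<xi> j)) \<longlonglongrightarrow> y"
    unfolding Omega_limit_def by blast
  have "(\<lambda>j. (\<xi> j, (f ^^ i j) (\<xi> j))) \<longlonglongrightarrow> (x, y)"
    by (intro tendsto_Pair \<xi> i)
  moreover have "\<forall>j. (\<xi> j, (f ^^ i j) (\<xi> j)) \<in> funpow_graph X f (i j)"
    using \<xi>(1) by (auto simp: funpow_graph_def)
  ultimately show "y \<in> X \<and> (x, y) \<in> kuratowski_limsup (funpow_graph X f)"
    using \<open>y \<in> X\<close> i(1) unfolding kuratowski_limsup_iff_sequential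
    by (intro conjI exI[of _ i] exI[of _ "\<lambda>j. (\<xi> j, (f ^^ i j) (\<xi> j))"])
next
  assume "y \<in> X \<and> (x, y) \<in> kuratowski_limsup (funpow_graph X f)"
  then obtain i :: "nat \<Rightarrow> nat" and u where "y \<in> X" and i: "strict_mono i"
    and u: "\<And>j. u j \<in> funpow_graph X f (i j)" "u \<longlonglongrightarrow> (x, y)"
    unfolding kuratowski_limsup_iff_sequential by blast
  have fst_u: "fst (u j) \<in> X" and snd_u: "snd (u j) = (f ^^ i j) (fst (u j))" for j
    using u(1)[of j] by (auto simp: funpow_graph_def)
  then have "range (\<lambda>j. fst (u j)) \<subseteq> X"
    by blast
  moreover have "(\<lambda>j. fst (u j)) \<longlonglongrightarrow> x" "(\<lambda>j. (f ^^ i j) (fst (u j))) \<longlonglongrightarrow> y"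
    using tendsto_fst[OF u(2)] tendsto_snd[OF u(2)] by (simp_all add: snd_u)
  ultimately show "y \<in> Omega_limit X f x"
    using Omega_limitI[OF \<open>y \<in> X\<close>] i by blast
qed

lemma closed_graph_Omega_limit:
  assumes "compact X"
  shows "closed (Sigma X (Omega_limit X f))"
proof -
  have "Sigma X (Omega_limit X f) = X \<times> X \<inter> kuratowski_limsup (funpow_graph X f)"
    by (auto simp: Omega_limit_iff_kuratowski_limsup)
  then show ?thesis
    using compact_imp_closed[OF assms] by (simp add: closed_Times closed_Int closed_kuratowski_limsup)
qed

lemma Omega_limit_subset: "Omega_limit X f x \<subseteq> X"
  unfolding Omega_limit_def by blast

lemma usc_at_Omega_limit: "compact X \<Longrightarrow> usc_at X (Omega_limit X f) x"
  by (intro usc_at_if_closed_graph closed_graph_Omega_limit Omega_limit_subset)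

lemma closed_Omega_limit:
  assumes "compact X" "x \<in> X"
  shows "closed (Omega_limit X f x)"
proof -
  have "Omega_limit X f x = Pair x -` Sigma X (Omega_limit X f)"
    using assms(2) by auto
  then show ?thesis
    using closed_vimage[OF closed_graph_Omega_limit[OF assms(1)], of "Pair x"]
    by (simp add: continuous_on_Pair)
qed

lemma omega_limit_subset_Omega_limit: "x \<in> X \<Longrightarrow> omega_limit X f x \<subseteq> Omega_limit X f x"
  unfolding omega_limit_def by (auto intro: Omega_limitI[of _ _ "\<lambda>_. x"])

lemma Omega_limit_orbit_passing_near:
  assumes "y \<in> Omega_limit X f x" "open A" "x \<in> A" "open B" "y \<in> B"
  obtains a m where "a \<in> X" "a \<in> A" "m \<ge> n" "(f ^^ m) a \<in> B"
proof -
  have "\<exists>\<^sub>F m in sequentially. funpow_graph X f m \<inter> A \<times> B \<noteq> {}"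
    using assms open_Times[OF assms(2,4)]
    by (simp add: Omega_limit_iff_kuratowski_limsup kuratowski_limsup_iff_frequently)
  then show thesis
    using that unfolding frequently_sequentially funpow_graph_def by blast
qed

lemma Omega_limit_subset_Omega_limit_image:
  assumes "continuous_on X f" "f ` X \<subseteq> X" "x \<in> X"
  shows "Omega_limit X f x \<subseteq> Omega_limit X f (f x)"
proof
  fix y
  assume "y \<in> Omega_limit X f x"
  then have "y \<in> X" and "(x, y) \<in> kuratowski_limsup (\<lambda>m. funpow_graph X f (m + 1))"
    by (simp_all only: Omega_limit_iff_kuratowski_limsup kuratowski_limsup_offset)
  then obtain i :: "nat \<Rightarrow> nat" and u where i: "strict_mono i"
    and u: "\<And>j. u j \<in> funpow_graph X f (i j + 1)" "u \<longlonglongrightarrow> (x, y)"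
    unfolding kuratowski_limsup_iff_sequential by blast
  have fst_u: "fst (u j) \<in> X" and snd_u: "snd (u j) = (f ^^ i j) (f (fst (u j)))" for j
    using u(1)[of j] by (auto simp: funpow_graph_def funpow_swap1)
  have "(\<lambda>j. f (fst (u j))) \<longlonglongrightarrow> f x"
    using tendsto_fst[OF u(2)] assms(1,3) fst_u
    by (intro continuous_on_tendsto_compose[OF assms(1)]) auto
  moreover have "(\<lambda>j. (f ^^ i j) (f (fst (u j)))) \<longlonglongrightarrow> y"
    using tendsto_snd[OF u(2)] by (simp add: snd_u)
  moreover have "range (\<lambda>j. f (fst (u j))) \<subseteq> X"
    using fst_u assms(2) by blast
  ultimately show "y \<in> Omega_limit X f (f x)"
    using Omega_limitI[OF \<open>y \<in> X\<close>] i by blast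
qed

lemma Omega_limit_subset_Omega_limit_funpow:
  assumes "continuous_on X f" "f ` X \<subseteq> X" "x \<in> X"
  shows "Omega_limit X f x \<subseteq> Omega_limit X f ((f ^^ n) x)"
proof (induction n)
  case (Suc n)
  have "Omega_limit X f ((f ^^ n) x) \<subseteq> Omega_limit X f (f ((f ^^ n) x))"
    using assms by (intro Omega_limit_subset_Omega_limit_image funpow_in_carrier)
  with Suc show ?case
    by simp
qed simp

lemma Omega_limit_subset_Omega_limit_if_mem_omega_limit:
  assumes "compact X" "continuous_on X f" "f ` X \<subseteq> X" "x \<in> X" "w \<in> omega_limit X f x"
  shows "Omega_limit X f x \<subseteq> Omega_limit X f w"
proof
  fix y
  assume "y \<in> Omega_limit X f x"
  then have "((f ^^ n) x, y) \<in> Sigma X (Omega_limit X f)" for n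
    using Omega_limit_subset_Omega_limit_funpow[OF assms(2-4)] funpow_in_carrier[OF assms(3,4)] by blast
  moreover obtain i :: "nat \<Rightarrow> nat" where "(\<lambda>j. (f ^^ i j) x) \<longlonglongrightarrow> w"
    using assms(5) unfolding omega_limit_def by blast
  then have "(\<lambda>j. ((f ^^ i j) x, y)) \<longlonglongrightarrow> (w, y)"
    by (intro tendsto_Pair tendsto_const)
  ultimately have "(w, y) \<in> Sigma X (Omega_limit X f)"
    by (rule closed_sequentially[OF closed_graph_Omega_limit[OF assms(1)]])
  then show "y \<in> Omega_limit X f w"
    by simp
qed

lemma omega_limit_meets_Omega_limit_if_usc_at:
  assumes X: "compact X" "f ` X \<subseteq> X"
    and usc: "usc_at X (omega_limit X f) x" and y: "y \<in> Omega_limit X f x"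
  shows "omega_limit X f x \<inter> Omega_limit X f y \<noteq> {}"
proof
  assume "omega_limit X f x \<inter> Omega_limit X f y = {}"
  moreover have "y \<in> X"
    using y Omega_limit_subset by blast
  ultimately obtain V W where "open V" "open W" and V: "omega_limit X f x \<subseteq> V"
    and W: "Omega_limit X f y \<subseteq> W" and disj: "V \<inter> W = {}"
    using t4_space[OF closed_omega_limit closed_Omega_limit] X(1) by meson
  obtain d where "d > 0" and d: "\<And>a. a \<in> X \<Longrightarrow> dist x a \<le> d \<Longrightarrow> omega_limit X f a \<subseteq> V"
    using usc_atE[OF usc \<open>open V\<close>] V by (auto simp: omega_limit_def)
  obtain e where "e > 0" and e: "\<And>b. b \<in> X \<Longrightarrow> dist y b \<le> e \<Longrightarrow> Omega_limit X f b \<subseteq> W"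
    using usc_atE[OF usc_at_Omega_limit[OF X(1)] \<open>open W\<close>] W Omega_limit_subset
    by (metis le_inf_iff)
  obtain a p where a: "a \<in> X" "a \<in> ball x d" "(f ^^ p) a \<in> ball y e"
    using Omega_limit_orbit_passing_near[OF y open_ball _ open_ball] \<open>d > 0\<close> \<open>e > 0\<close>
    by (metis centre_in_ball)
  have orbit_in_X: "(f ^^ p) a \<in> X"
    by (rule funpow_in_carrier[OF X(2) a(1)])
  have "omega_limit X f a = omega_limit X f ((f ^^ p) a)"
    by (rule omega_limit_funpow[symmetric])
  also have "\<dots> \<subseteq> Omega_limit X f ((f ^^ p) a)"
    by (rule omega_limit_subset_Omega_limit[OF orbit_in_X])
  also have "\<dots> \<subseteq> W"
    using e[OF orbit_in_X] a(3) by simp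
  finally have "omega_limit X f a = {}"
    using d[OF a(1)] a(2) disj by auto
  then show False
    using omega_limit_in_closed_hyperspace[OF X a(1)] by (simp add: closed_hyperspace_def)
qed

subsection \<open>Chains and shadowing\<close>

definition chain_step :: "'a::metric_space set \<Rightarrow> ('a \<Rightarrow> 'a) \<Rightarrow> real \<Rightarrow> 'a \<Rightarrow> 'a \<Rightarrow> bool" where
  "chain_step X f \<delta> u v \<longleftrightarrow> v \<in> X \<and> dist (f u) v \<le> \<delta>"

definition chain_reachable :: "'a::metric_space set \<Rightarrow> ('a \<Rightarrow> 'a) \<Rightarrow> 'a \<Rightarrow> 'a \<Rightarrow> bool" where
  "chain_reachable X f u v \<longleftrightarrow> (\<forall>\<delta>>0. (chain_step X f \<delta>)\<^sup>+\<^sup>+ u v)"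

lemma chain_reachable_trans:
  "chain_reachable X f u v \<Longrightarrow> chain_reachable X f v w \<Longrightarrow> chain_reachable X f u w"
  unfolding chain_reachable_def by (meson tranclp_trans)

lemma pseudo_orbit_if_chain_steps:
  assumes "\<xi> 0 \<in> X" "\<And>i. chain_step X f \<delta> (\<xi> i) (\<xi> (Suc i))"
  shows "pseudo_orbit X f \<delta> \<xi>"
proof -
  have "\<xi> i \<in> X" for i
    using assms by (cases i) (auto simp: chain_step_def)
  then show ?thesis
    using assms(2) by (auto simp: pseudo_orbit_def chain_step_def)
qed

lemma rtranclp_chain_step_funpow:
  assumes "f ` X \<subseteq> X" "a \<in> X" "\<delta> \<ge> 0"
  shows "(chain_step X f \<delta>)\<^sup>*\<^sup>* a ((f ^^ n) a)"
proof (induction n)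
  case (Suc n)
  have "chain_step X f \<delta> ((f ^^ n) a) ((f ^^ Suc n) a)"
    using funpow_in_carrier[OF assms(1,2), of "Suc n"] assms(3) by (simp add: chain_step_def)
  with Suc show ?case
    by (rule rtranclp.rtrancl_into_rtrancl)
qed simp

lemma chain_reachable_if_Omega_limit:
  assumes "continuous_on X f" "f ` X \<subseteq> X" "x \<in> X" "y \<in> Omega_limit X f x"
  shows "chain_reachable X f x y"
  unfolding chain_reachable_def
proof (intro allI impI)
  fix \<delta> :: real
  assume "\<delta> > 0"
  then obtain e where "e > 0" and e: "\<And>a. a \<in> X \<Longrightarrow> dist a x < e \<Longrightarrow> dist (f a) (f x) < \<delta>"
    using assms(1,3) unfolding continuous_on_iff by blast
  obtain a m where a: "a \<in> X" "a \<in> ball x e" and m: "m \<ge> 2" "(f ^^ m) a \<in> ball y \<delta>"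
    using Omega_limit_orbit_passing_near[OF assms(4) open_ball _ open_ball] \<open>e > 0\<close> \<open>\<delta> > 0\<close>
    by (metis centre_in_ball)
  obtain k where k: "m = Suc (Suc k)"
    using m(1) by (metis One_nat_def Suc_1 Suc_le_D Suc_le_mono)
  have "f a \<in> X"
    using a(1) assms(2) by blast
  then have "chain_step X f \<delta> x (f a)"
    using e[OF a(1)] a(2) by (simp add: chain_step_def dist_commute)
  moreover have "(chain_step X f \<delta>)\<^sup>*\<^sup>* (f a) ((f ^^ k) (f a))"
    using rtranclp_chain_step_funpow[OF assms(2) \<open>f a \<in> X\<close>] \<open>\<delta> > 0\<close> by simp
  moreover have "chain_step X f \<delta> ((f ^^ k) (f a)) y"
    using assms(4) Omega_limit_subset m(2) k
    by (auto simp: chain_step_def dist_commute funpow_swap1)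
  ultimately show "(chain_step X f \<delta>)\<^sup>+\<^sup>+ x y"
    by (meson rtranclp_into_tranclp2 tranclp.trancl_into_trancl rtranclp_into_tranclp1)
qed

lemma tranclp_loop_sequence:
  assumes "R\<^sup>+\<^sup>+ y y"
  obtains \<xi> :: "nat \<Rightarrow> 'a"
  where "\<xi> 0 = y" "\<And>i. R (\<xi> i) (\<xi> (Suc i))" "\<exists>\<^sub>F m in sequentially. \<xi> m = y"
proof -
  obtain n where n: "n > 0" "(R ^^ n) y y"
    using assms by (auto simp: tranclp_power)
  then obtain g where g: "g 0 = y" "g n = y" "\<And>i. i < n \<Longrightarrow> R (g i) (g (Suc i))"
    unfolding relpowp_fun_conv by blast
  have "R (g (i mod n)) (g (Suc i mod n))" for i
    using g(3)[of "i mod n"] g(1,2) n(1) by (auto simp: mod_Suc)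
  moreover have "\<exists>m\<ge>k. g (m mod n) = y" for k
    using g(1) n(1) by (intro exI[of _ "n * k"]) simp
  ultimately show thesis
    using that[of "\<lambda>i. g (i mod n)"] g(1) by (simp add: frequently_sequentially)
qed

lemma rtranclp_prepend_sequence:
  fixes \<eta> :: "nat \<Rightarrow> 'a"
  assumes "R\<^sup>*\<^sup>* x (\<eta> 0)" "\<And>i. R (\<eta> i) (\<eta> (Suc i))"
  obtains \<xi> k where "\<xi> 0 = x" "\<And>i. R (\<xi> i) (\<xi> (Suc i))" "\<And>i. \<xi> (i + k) = \<eta> i"
proof -
  have "\<exists>\<xi> k. \<xi> 0 = x \<and> (\<forall>i. R (\<xi> i) (\<xi> (Suc i))) \<and> (\<forall>i. \<xi> (i + k) = \<eta> i)"
    using assms(1)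
  proof (induction rule: converse_rtranclp_induct)
    case base
    show ?case
      using assms(2) by (intro exI[of _ \<eta>] exI[of _ 0]) simp
  next
    case (step u v)
    then obtain \<xi> k where \<xi>: "\<xi> 0 = v" "\<And>i. R (\<xi> i) (\<xi> (Suc i))" "\<And>i. \<xi> (i + k) = \<eta> i"
      by blast
    have "R (case_nat u \<xi> i) (case_nat u \<xi> (Suc i))" for i
      using \<xi>(1,2) step.hyps(1) by (cases i) simp_all
    then show ?case
      using \<xi>(3) by (intro exI[of _ "case_nat u \<xi>"] exI[of _ "Suc k"]) simp
  qed
  then show thesis
    using that by blast
qed

lemma pseudo_orbit_through_loop:
  assumes "x \<in> X" and reach: "chain_reachable X f x y" "chain_reachable X f y y" and "\<delta> > 0"
  obtains \<xi> where "pseudo_orbit X f \<delta> \<xi>" "\<xi> 0 = x" "\<exists>\<^sub>F m in sequentially. \<xi> m = y"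
proof -
  have chains: "(chain_step X f \<delta>)\<^sup>*\<^sup>* x y" "(chain_step X f \<delta>)\<^sup>+\<^sup>+ y y"
    using reach \<open>\<delta> > 0\<close> by (auto simp: chain_reachable_def dest: tranclp_into_rtranclp)
  obtain \<eta> where \<eta>: "\<eta> 0 = y" "\<And>i. chain_step X f \<delta> (\<eta> i) (\<eta> (Suc i))"
    "\<exists>\<^sub>F m in sequentially. \<eta> m = y"
    using tranclp_loop_sequence[OF chains(2)] by blast
  obtain \<xi> k where \<xi>: "\<xi> 0 = x" "\<And>i. chain_step X f \<delta> (\<xi> i) (\<xi> (Suc i))" "\<And>i. \<xi> (i + k) = \<eta> i"
    using rtranclp_prepend_sequence[of "chain_step X f \<delta>" x \<eta>] chains(1) \<eta>(1,2) by auto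
  have "\<exists>\<^sub>F m in sequentially. \<xi> m = y"
    using \<eta>(3) \<xi>(3) eventually_sequentially_seg[of "\<lambda>m. \<xi> m \<noteq> y" k] by (simp add: frequently_def)
  then show thesis
    using that pseudo_orbit_if_chain_steps \<xi>(1,2) \<open>x \<in> X\<close> by blast
qed

lemma shadowable_imp_omega_limit_meets_cball:
  assumes X: "compact X" "f ` X \<subseteq> X" "x \<in> X" and shadowable: "shadowable X f x"
    and reach: "chain_reachable X f x y" "chain_reachable X f y y" and "\<epsilon> > 0"
  obtains z where "z \<in> X" "dist x z \<le> \<epsilon>" "cball y \<epsilon> \<inter> omega_limit X f z \<noteq> {}"
proof -
  obtain \<delta> where "\<delta> > 0"
    and \<delta>: "\<And>\<xi>. pseudo_orbit X f \<delta> \<xi> \<Longrightarrow> \<xi> 0 = x \<Longrightarrow> \<exists>z\<in>X. shadowed_by f \<epsilon> \<xi> z"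
    using shadowable \<open>\<epsilon> > 0\<close> unfolding shadowable_def by blast
  obtain \<xi> where "pseudo_orbit X f \<delta> \<xi>" "\<xi> 0 = x" and freq: "\<exists>\<^sub>F m in sequentially. \<xi> m = y"
    using pseudo_orbit_through_loop[OF X(3) reach \<open>\<delta> > 0\<close>] by blast
  then obtain z where "z \<in> X" and z: "\<And>i. dist (\<xi> i) ((f ^^ i) z) \<le> \<epsilon>"
    using \<delta> unfolding shadowed_by_def by blast
  have "\<exists>\<^sub>F m in sequentially. (f ^^ m) z \<in> X \<inter> cball y \<epsilon>"
    using freq
  proof (rule frequently_elim1)
    fix m
    assume "\<xi> m = y"
    then show "(f ^^ m) z \<in> X \<inter> cball y \<epsilon>"
      using z[of m] funpow_in_carrier[OF X(2) \<open>z \<in> X\<close>] by simp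
  qed
  then have "X \<inter> cball y \<epsilon> \<inter> omega_limit X f z \<noteq> {}"
    using X(1) by (intro omega_limit_meets_compact compact_Int_closed) auto
  moreover have "dist x z \<le> \<epsilon>"
    using z[of 0] \<open>\<xi> 0 = x\<close> by simp
  ultimately show thesis
    using that \<open>z \<in> X\<close> by blast
qed

lemma chain_recurrent_mem_omega_limit_if_usc_at:
  assumes X: "compact X" "f ` X \<subseteq> X" "x \<in> X" and shadowable: "shadowable X f x"
    and usc: "usc_at X (omega_limit X f) x"
    and reach: "chain_reachable X f x y" "chain_reachable X f y y"
  shows "y \<in> omega_limit X f x"
proof (rule ccontr)
  assume "y \<notin> omega_limit X f x"
  then obtain r where "r > 0" and r: "cball y r \<subseteq> - omega_limit X f x"
    using open_contains_cball[of "- omega_limit X f x"] closed_omega_limit[OF X(1)] by blast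
  have "open (- cball y r)" "omega_limit X f x \<subseteq> X \<inter> - cball y r"
    using r by (auto simp: omega_limit_def)
  then obtain d where "d > 0"
    and d: "\<And>z. z \<in> X \<Longrightarrow> dist x z \<le> d \<Longrightarrow> omega_limit X f z \<subseteq> - cball y r"
    using usc_atE[OF usc] by metis
  obtain z where "z \<in> X" "dist x z \<le> min d r" "cball y (min d r) \<inter> omega_limit X f z \<noteq> {}"
    using shadowable_imp_omega_limit_meets_cball[OF X shadowable reach, of "min d r"] \<open>d > 0\<close> \<open>r > 0\<close>
    by auto
  then show False
    using d[OF \<open>z \<in> X\<close>] by auto
qed

lemma Omega_limit_subset_omega_limit_if_usc_at:
  assumes X: "compact X" "continuous_on X f" "f ` X \<subseteq> X" and "x \<in> X"
    and shadowable: "shadowable X f x" and usc: "usc_at X (omega_limit X f) x"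
  shows "Omega_limit X f x \<subseteq> omega_limit X f x"
proof
  fix y
  assume y: "y \<in> Omega_limit X f x"
  then have "y \<in> X"
    using Omega_limit_subset by blast
  obtain w where w: "w \<in> omega_limit X f x" "w \<in> Omega_limit X f y"
    using omega_limit_meets_Omega_limit_if_usc_at[OF X(1,3) usc y] by blast
  then have "w \<in> X" "y \<in> Omega_limit X f w"
    using Omega_limit_subset Omega_limit_subset_Omega_limit_if_mem_omega_limit[OF X \<open>x \<in> X\<close> w(1)] y by blast+
  note reachable = chain_reachable_if_Omega_limit[OF X(2,3)]
  have "chain_reachable X f y y"
    using reachable[OF \<open>y \<in> X\<close> w(2)] reachable[OF \<open>w \<in> X\<close> \<open>y \<in> Omega_limit X f w\<close>]
    by (rule chain_reachable_trans)
  with reachable[OF \<open>x \<in> X\<close> y] show "y \<in> omega_limit X f x"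
    using chain_recurrent_mem_omega_limit_if_usc_at[OF X(1,3) \<open>x \<in> X\<close> shadowable usc] by blast
qed

theorem theorem2p1:
  fixes X :: "'a::metric_space set" and f :: "'a \<Rightarrow> 'a" and x :: 'a
  assumes "compact X" and "continuous_on X f" and "f ` X \<subseteq> X" and "x \<in> Sh X f"
  shows "x \<in> USC X (omega_limit X f) \<longleftrightarrow> omega_limit X f x = Omega_limit X f x"
proof
  have x: "x \<in> X" "shadowable X f x"
    using assms(4) by (simp_all add: Sh_def)
  show "omega_limit X f x = Omega_limit X f x" if "x \<in> USC X (omega_limit X f)"
  proof
    show "omega_limit X f x \<subseteq> Omega_limit X f x"
      by (rule omega_limit_subset_Omega_limit[OF x(1)])
    show "Omega_limit X f x \<subseteq> omega_limit X f x"
      using that by (intro Omega_limit_subset_omega_limit_if_usc_at[OF assms(1-3) x]) (simp add: USC_def)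
  qed
  show "x \<in> USC X (omega_limit X f)" if "omega_limit X f x = Omega_limit X f x"
    using usc_at_if_subset_usc_at[OF usc_at_Omega_limit[OF assms(1)] _ omega_limit_subset_Omega_limit]
      that x(1) by (simp add: USC_def)
qed

end
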